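(* Let $k$ be a field of characteristic $\neq 2$, let $A$ be a unitary associative $k$-algebra of finite dimension at least $2$, and let $x,y\in k$ be nonzero scalars. Let $\mu:A\to A$ be a bijective $k$-linear map and let $\alpha,\beta\in k$ be nonzero scalars. Then $(R_{x,y},\mu,\alpha,\beta)$ is an enhanced Yang--Baxter operator if, and only if, there exists a scalar $c\in k$ such that $c\cdot\mu$ is a $k$-algebra automorphism of $A$ and the following conditions are satisfied: $$ \begin{cases} x=c\,\alpha\beta,\\ y^{-1}=c\,\alpha^{-1}\beta,\\ \mathrm{Trace}\left(A\to A,\ b\mapsto a\,\mu(b)\right)=0 \quad\text{for all } a\in A. \end{cases} $$
   Context: Tensor products are over $k$. A Yang--Baxter (YB) operator on a $k$-vector space $V$ is an invertible $k$-linear map $R:V\otimes V\to V\otimes V$ with $R^{12}\circ R^{23}\circ R^{12}=R^{23}\circ R^{12}\circ R^{23}$ on $V^{\otimes 3}$, where $R^{12}=R\otimes \mathrm{Id}$ and $R^{23}=\mathrm{Id}\otimes R$. For nonzero $x,y\in k$, $R_{x,y}:A\otimes A\to A\otimes A$ is the $k$-linear map $R_{x,y}(a\otimes b)=x\cdot ab\otimes 1+y\cdot 1\otimes ab-x\cdot a\otimes b$. It is known to be a YB operator (Dăscălescu--Nichita), with inverse $R_{x,y}^{-1}(a\otimes b)=y^{-1}\cdot ab\otimes 1+x^{-1}\cdot 1\otimes ab-x^{-1}\cdot a\otimes b$. Operator trace: let $V$ be finite-dimensional with basis $e_1,\dots,e_d$ and let $f:V\otimes V\to V\otimes V$ be linear,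 with $f(e_{i}\otimes e_{l})=\sum_{j,m} f^{jm}_{il}\,e_{j}\otimes e_{m}$. Then $\mathrm{Sp}_2(f):V\to V$ is the linear map $\mathrm{Sp}_2(f)(e_i)=\sum_{j,l} f^{jl}_{il}\,e_j$ (partial trace over the last factor; it is independent of the basis). An enhanced YB operator is a quadruplet $(R,\mu,\alpha,\beta)$ where $R$ is a YB operator on a finite-dimensional $k$-vector space $V$, $\mu:V\to V$ is a bijective $k$-linear map and $\alpha,\beta\in k$ are nonzero, such that $R\circ(\mu\otimes\mu)=(\mu\otimes\mu)\circ R$ and $\mathrm{Sp}_2(R^{\pm1}\circ(\mathrm{Id}\otimes\mu))=\alpha^{\pm1}\beta\cdot\mathrm{Id}$ (for both signs). *)

theory Defs
  imports Complex_Main "HOL-Library.Function_Algebras"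
begin

section \<open>Tensor powers of a vector space\<close>

text \<open>
  Over a field, the second and third tensor powers of \<open>V\<close> embed canonically into the multilinear
  forms on the dual of \<open>V\<close>: the pure tensor of \<open>v\<close> and \<open>w\<close> is the form that sends \<open>(\<phi>, \<psi>)\<close> to
  \<open>\<phi>(v) \<psi>(w)\<close>. We take the tensor powers to be the spans of the pure tensors inside these spaces of
  forms. No basis is involved, and the iterated tensor product is associative on the nose.
  Tensors are total functions of their arguments, and vanish on arguments that are not linear.
  The additive structure on these functions is the pointwise one of
  \<^theory>\<open>HOL-Library.Function_Algebras\<close>.
\<close>

type_synonym ('k, 'v) tensor2 = "('v \<Rightarrow> 'k) \<Rightarrow> ('v \<Rightarrow> 'k) \<Rightarrow> 'k"
type_synonym ('k, 'v) tensor3 = "('v \<Rightarrow> 'k) \<Rightarrow> ('v \<Rightarrow> 'k) \<Rightarrow> ('v \<Rightarrow> 'k) \<Rightarrow> 'k"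

definition tscale2 :: "'k::field \<Rightarrow> ('k, 'v) tensor2 \<Rightarrow> ('k, 'v) tensor2"
  where "tscale2 c t = (\<lambda>\<phi> \<psi>. c * t \<phi> \<psi>)"

definition tscale3 :: "'k::field \<Rightarrow> ('k, 'v) tensor3 \<Rightarrow> ('k, 'v) tensor3"
  where "tscale3 c t = (\<lambda>\<phi> \<psi> \<chi>. c * t \<phi> \<psi> \<chi>)"

lemma vector_space_tscale2: "vector_space (tscale2 :: 'k::field \<Rightarrow> ('k, 'v) tensor2 \<Rightarrow> _)"
  by unfold_locales (auto simp: tscale2_def fun_eq_iff algebra_simps)

lemma vector_space_tscale3: "vector_space (tscale3 :: 'k::field \<Rightarrow> ('k, 'v) tensor3 \<Rightarrow> _)"
  by unfold_locales (auto simp: tscale3_def fun_eq_iff algebra_simps)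

interpretation T2: vector_space "tscale2 :: 'k::field \<Rightarrow> ('k, 'v) tensor2 \<Rightarrow> _"
  by (rule vector_space_tscale2)

interpretation T3: vector_space "tscale3 :: 'k::field \<Rightarrow> ('k, 'v) tensor3 \<Rightarrow> _"
  by (rule vector_space_tscale3)

text \<open>Linearity of a map that matters only on a subspace \<open>S\<close>.\<close>

definition linear_on ::
  "'v set \<Rightarrow> ('k \<Rightarrow> 'v \<Rightarrow> 'v) \<Rightarrow> ('k \<Rightarrow> 'w \<Rightarrow> 'w) \<Rightarrow> ('v::plus \<Rightarrow> 'w::plus) \<Rightarrow> bool"
  where "linear_on S s1 s2 f \<longleftrightarrow>
    (\<forall>u\<in>S. \<forall>v\<in>S. f (u + v) = f u + f v) \<and> (\<forall>c. \<forall>u\<in>S. f (s1 c u) = s2 c (f u))"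

locale tensor_powers = vector_space scale
  for scale :: "'a::field \<Rightarrow> 'b::ab_group_add \<Rightarrow> 'b"  (infixr "*s" 75)
begin

definition dual :: "('b \<Rightarrow> 'a) set"
  where "dual = {\<phi>. Vector_Spaces.linear scale (*) \<phi>}"

definition tensor :: "'b \<Rightarrow> 'b \<Rightarrow> ('a, 'b) tensor2"  (infixl "\<otimes>" 76)
  where "v \<otimes> w = (\<lambda>\<phi> \<psi>. if \<phi> \<in> dual \<and> \<psi> \<in> dual then \<phi> v * \<psi> w else 0)"

definition tensor3 :: "'b \<Rightarrow> 'b \<Rightarrow> 'b \<Rightarrow> ('a, 'b) tensor3"
  where "tensor3 u v w =
    (\<lambda>\<phi> \<psi> \<chi>. if \<phi> \<in> dual \<and> \<psi> \<in> dual \<and> \<chi> \<in> dual then \<phi> u * \<psi> v * \<chi> w else 0)"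

definition tensor2_space :: "('a, 'b) tensor2 set"
  where "tensor2_space = T2.span {v \<otimes> w | v w. True}"

definition tensor3_space :: "('a, 'b) tensor3 set"
  where "tensor3_space = T3.span {tensor3 u v w | u v w. True}"

text \<open>
  The linear map on the second tensor power that is induced by a bilinear map; it exists and is
  unique on the tensor power, see \<open>tensor_lift\<close> and \<open>tensor_lift_unique\<close> below.
\<close>

definition tensor_lift :: "('a \<Rightarrow> 'w \<Rightarrow> 'w) \<Rightarrow> ('b \<Rightarrow> 'b \<Rightarrow> 'w) \<Rightarrow> ('a, 'b) tensor2 \<Rightarrow> 'w::ab_group_add"
  where "tensor_lift s b =
    (SOME L. linear_on tensor2_space tscale2 s L \<and> (\<forall>v w. L (v \<otimes> w) = b v w))"

definition tensor_map :: "('b \<Rightarrow> 'b) \<Rightarrow> ('b \<Rightarrow> 'b) \<Rightarrow> ('a, 'b) tensor2 \<Rightarrow> ('a, 'b) tensor2"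
  where "tensor_map f g = tensor_lift tscale2 (\<lambda>v w. f v \<otimes> g w)"

text \<open>
  \<open>leg12 R\<close> is \<open>R \<otimes> Id\<close> and \<open>leg23 R\<close> is \<open>Id \<otimes> R\<close> on the third tensor power: contracting the leg
  that is not acted upon with a functional leaves a 2-tensor, to which \<open>R\<close> is applied. On pure
  tensors this gives \<open>R(u \<otimes> v) \<otimes> w\<close> and \<open>u \<otimes> R(v \<otimes> w)\<close>, see \<open>leg12_tensor3\<close> and
  \<open>leg23_tensor3\<close> below.
\<close>

definition leg12 :: "(('a, 'b) tensor2 \<Rightarrow> ('a, 'b) tensor2) \<Rightarrow> ('a, 'b) tensor3 \<Rightarrow> ('a, 'b) tensor3"
  where "leg12 R t = (\<lambda>\<phi> \<psi> \<chi>. R (\<lambda>\<phi>' \<psi>'. t \<phi>' \<psi>' \<chi>) \<phi> \<psi>)"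

definition leg23 :: "(('a, 'b) tensor2 \<Rightarrow> ('a, 'b) tensor2) \<Rightarrow> ('a, 'b) tensor3 \<Rightarrow> ('a, 'b) tensor3"
  where "leg23 R t = (\<lambda>\<phi>. R (t \<phi>))"

definition YB_operator :: "(('a, 'b) tensor2 \<Rightarrow> ('a, 'b) tensor2) \<Rightarrow> bool"
  where "YB_operator R \<longleftrightarrow>
    linear_on tensor2_space tscale2 tscale2 R \<and>
    bij_betw R tensor2_space tensor2_space \<and>
    (\<forall>t\<in>tensor3_space.
       leg12 R (leg23 R (leg12 R t)) = leg23 R (leg12 R (leg23 R t)))"

end


section \<open>Traces and enhanced Yang--Baxter operators\<close>

text \<open>
  The locale fixes some basis of the space. Traces are computed in that basis, although
  their values do not depend on it.
\<close>

locale finite_dimensional_tensor_powers =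
  tensor_powers scale + finite_dimensional_vector_space scale Basis
  for scale :: "'a::field \<Rightarrow> 'b::ab_group_add \<Rightarrow> 'b"  (infixr "*s" 75)
  and Basis :: "'b set"
begin

definition trace :: "('b \<Rightarrow> 'b) \<Rightarrow> 'a"
  where "trace f = (\<Sum>i\<in>Basis. representation Basis (f i) i)"

definition tensor2_Basis :: "('a, 'b) tensor2 set"
  where "tensor2_Basis = {i \<otimes> j | i j. i \<in> Basis \<and> j \<in> Basis}"

text \<open>
  \<open>tensor_coeff f i l j m\<close> is the coefficient of \<open>j \<otimes> m\<close> in \<open>f (i \<otimes> l)\<close>, for \<open>i\<close>, \<open>l\<close>, \<open>j\<close>, \<open>m\<close>
  in the basis.
\<close>

definition tensor_coeff ::
  "(('a, 'b) tensor2 \<Rightarrow> ('a, 'b) tensor2) \<Rightarrow> 'b \<Rightarrow> 'b \<Rightarrow> 'b \<Rightarrow> 'b \<Rightarrow> 'a"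
  where "tensor_coeff f i l j m = T2.representation tensor2_Basis (f (i \<otimes> l)) (j \<otimes> m)"

definition Sp2 :: "(('a, 'b) tensor2 \<Rightarrow> ('a, 'b) tensor2) \<Rightarrow> 'b \<Rightarrow> 'b"
  where "Sp2 f v = (\<Sum>i\<in>Basis. representation Basis v i *s
    (\<Sum>j\<in>Basis. \<Sum>l\<in>Basis. tensor_coeff f i l j l *s j))"

definition enhanced_YB_operator ::
  "(('a, 'b) tensor2 \<Rightarrow> ('a, 'b) tensor2) \<Rightarrow> ('b \<Rightarrow> 'b) \<Rightarrow> 'a \<Rightarrow> 'a \<Rightarrow> bool"
  where "enhanced_YB_operator R \<mu> \<alpha> \<beta> \<longleftrightarrow>
    YB_operator R \<and>
    Vector_Spaces.linear scale scale \<mu> \<and> bij \<mu> \<and> \<alpha> \<noteq> 0 \<and> \<beta> \<noteq> 0 \<and>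
    (\<forall>t\<in>tensor2_space. R (tensor_map \<mu> \<mu> t) = tensor_map \<mu> \<mu> (R t)) \<and>
    (\<forall>v. Sp2 (R \<circ> tensor_map id \<mu>) v = (\<alpha> * \<beta>) *s v) \<and>
    (\<forall>v. Sp2 (inv_into tensor2_space R \<circ> tensor_map id \<mu>) v = (inverse \<alpha> * \<beta>) *s v)"

end


section \<open>Algebras and the operators of Dascalescu and Nichita\<close>

locale finite_dimensional_algebra = finite_dimensional_tensor_powers scale Basis
  for scale :: "'k::field \<Rightarrow> 'a::ring_1 \<Rightarrow> 'a"  (infixr "*s" 75)
  and Basis :: "'a set" +
  assumes scale_mult_left: "(c *s a) * b = c *s (a * b)"
    and scale_mult_right: "a * (c *s b) = c *s (a * b)"
begin

definition algebra_automorphism :: "('a \<Rightarrow> 'a) \<Rightarrow> bool"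
  where "algebra_automorphism f \<longleftrightarrow>
    Vector_Spaces.linear scale scale f \<and> bij f \<and> f 1 = 1 \<and> (\<forall>a b. f (a * b) = f a * f b)"

definition DN_operator :: "'k \<Rightarrow> 'k \<Rightarrow> ('k, 'a) tensor2 \<Rightarrow> ('k, 'a) tensor2"
  where "DN_operator x y = tensor_lift tscale2
    (\<lambda>a b. tscale2 x ((a * b) \<otimes> 1) + tscale2 y (1 \<otimes> (a * b)) - tscale2 x (a \<otimes> b))"

end


section \<open>Well-definedness\<close>

lemma linear_on_span_eq:
  assumes "module s1" "linear_on (module.span s1 G) s1 s2 f" "linear_on (module.span s1 G) s1 s2 g"
    and "\<And>x. x \<in> G \<Longrightarrow> f x = g x" and "t \<in> module.span s1 G"
    and "vector_space (s2 :: 'k::field \<Rightarrow> 'w::ab_group_add \<Rightarrow> 'w)"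
  shows "f t = g t"
proof -
  interpret m: module s1 by fact
  interpret w: vector_space s2 by fact
  have zero: "f 0 = 0" "g 0 = 0"
    using assms(2,3) m.span_zero[of G] unfolding linear_on_def
    by (metis m.scale_zero_left w.scale_zero_left)+
  have "t \<in> m.span G \<and> f t = g t"
    using assms(5)
  proof (induction rule: m.span_induct_alt)
    case base
    then show ?case using zero by (simp add: m.span_zero)
  next
    case (step c x y)
    have "x \<in> m.span G" using step.hyps by (rule m.span_base)
    then show ?case
      using step assms(2-4) unfolding linear_on_def
      by (simp add: m.span_add m.span_scale)
  qed
  then show ?thesis by blast
qed

context tensor_powers
begin

lemma dual_add: "\<phi> \<in> dual \<Longrightarrow> \<phi> (u + v) = \<phi> u + \<phi> v"
  and dual_scale: "\<phi> \<in> dual \<Longrightarrow> \<phi> (c *s v) = c * \<phi> v"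
  unfolding dual_def Vector_Spaces.linear_iff by auto

lemma tensor_add_left: "(u + v) \<otimes> w = u \<otimes> w + v \<otimes> w"
  and tensor_add_right: "w \<otimes> (u + v) = w \<otimes> u + w \<otimes> v"
  and tensor_scale_left: "(c *s v) \<otimes> w = tscale2 c (v \<otimes> w)"
  and tensor_scale_right: "v \<otimes> (c *s w) = tscale2 c (v \<otimes> w)"
  by (auto simp: tensor_def tscale2_def fun_eq_iff dual_add dual_scale algebra_simps)

lemma tensor_in_space [simp]: "v \<otimes> w \<in> tensor2_space"
  unfolding tensor2_space_def by (rule T2.span_base) auto

lemma tensor_lift_unique:
  assumes "linear_on tensor2_space tscale2 s L" "linear_on tensor2_space tscale2 s L'"
    and "\<And>v w. L (v \<otimes> w) = L' (v \<otimes> w)" and "vector_space s" and "t \<in> tensor2_space"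
  shows "L t = L' t"
proof (rule linear_on_span_eq[where f = L and g = L' and t = t and G = "{v \<otimes> w | v w. True}", OF T2.module_axioms])
  show "linear_on (T2.span {v \<otimes> w | v w. True}) tscale2 s L"
    "linear_on (T2.span {v \<otimes> w | v w. True}) tscale2 s L'"
    "t \<in> T2.span {v \<otimes> w | v w. True}"
    by (fact assms(1,2,5)[unfolded tensor2_space_def])+
  show "L x = L' x" if "x \<in> {v \<otimes> w | v w. True}" for x
    using that assms(3) by blast
qed (fact assms(4))

lemma leg12_tensor3:
  assumes "linear_on tensor2_space tscale2 tscale2 R"
  shows "leg12 R (tensor3 u v w) = (\<lambda>\<phi> \<psi> \<chi>. if \<chi> \<in> dual then R (u \<otimes> v) \<phi> \<psi> * \<chi> w else 0)"
proof -
  have eq: "(\<lambda>\<phi> \<psi>. tensor3 u v w \<phi> \<psi> \<chi>) = tscale2 (if \<chi> \<in> dual then \<chi> w else 0) (u \<otimes> v)" for \<chi>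
    by (auto simp: tensor3_def tensor_def tscale2_def fun_eq_iff)
  have R: "R (tscale2 c (u \<otimes> v)) = tscale2 c (R (u \<otimes> v))" for c
    using assms unfolding linear_on_def by simp
  show ?thesis
    unfolding leg12_def eq R by (simp add: tscale2_def fun_eq_iff)
qed

lemma leg23_tensor3:
  assumes "linear_on tensor2_space tscale2 tscale2 R"
  shows "leg23 R (tensor3 u v w) = (\<lambda>\<phi> \<psi> \<chi>. if \<phi> \<in> dual then \<phi> u * R (v \<otimes> w) \<psi> \<chi> else 0)"
proof -
  have eq: "tensor3 u v w \<phi> = tscale2 (if \<phi> \<in> dual then \<phi> u else 0) (v \<otimes> w)" for \<phi>
    by (auto simp: tensor3_def tensor_def tscale2_def fun_eq_iff)
  have R: "R (tscale2 c (v \<otimes> w)) = tscale2 c (R (v \<otimes> w))" for c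
    using assms unfolding linear_on_def by simp
  show ?thesis
    unfolding leg23_def eq R by (simp add: tscale2_def fun_eq_iff)
qed

end

context finite_dimensional_tensor_powers
begin

lemma coordinate_in_dual: "(\<lambda>v. representation Basis v i) \<in> dual"
  unfolding dual_def using linear_representation[OF independent_Basis span_Basis] by simp

lemma basis_expansion: "(\<Sum>i\<in>Basis. representation Basis v i *s i) = v"
  by (rule sum_representation_eq)
    (auto simp: independent_Basis span_Basis finite_Basis)

lemma tensor_lift:
  fixes s :: "'a \<Rightarrow> 'w \<Rightarrow> 'w::ab_group_add"
  assumes l: "\<And>w. Vector_Spaces.linear scale s (\<lambda>v. b v w)" and r: "\<And>v. Vector_Spaces.linear scale s (b v)"
  shows "linear_on tensor2_space tscale2 s (tensor_lift s b)"
    and "tensor_lift s b (v \<otimes> w) = b v w"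
proof -
  interpret w: vector_space s
    using r[of 0] unfolding Vector_Spaces.linear_iff by blast
  let ?e = "\<lambda>i v. representation Basis v i"
  let ?L = "\<lambda>t. \<Sum>i\<in>Basis. \<Sum>j\<in>Basis. s (t (?e i) (?e j)) (b i j)"
  have "linear_on tensor2_space tscale2 s ?L"
    unfolding linear_on_def
    by (simp add: tscale2_def w.scale_left_distrib sum.distrib w.scale_sum_right)
  moreover have "?L (v \<otimes> w) = b v w" for v w
  proof -
    have "b v w = b (\<Sum>i\<in>Basis. ?e i v *s i) (\<Sum>j\<in>Basis. ?e j w *s j)"
      by (simp add: basis_expansion)
    also have "\<dots> = (\<Sum>i\<in>Basis. s (?e i v) (b i (\<Sum>j\<in>Basis. ?e j w *s j)))"
    proof -
      interpret Vector_Spaces.linear scale s "\<lambda>v. b v (\<Sum>j\<in>Basis. ?e j w *s j)" by (rule l)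
      show ?thesis by (simp add: sum scale)
    qed
    also have "\<dots> = (\<Sum>i\<in>Basis. s (?e i v) (\<Sum>j\<in>Basis. s (?e j w) (b i j)))"
    proof (rule sum.cong)
      fix i
      interpret Vector_Spaces.linear scale s "b i" by (rule r)
      show "s (?e i v) (b i (\<Sum>j\<in>Basis. ?e j w *s j)) = s (?e i v) (\<Sum>j\<in>Basis. s (?e j w) (b i j))"
        by (simp add: sum scale)
    qed simp
    also have "\<dots> = ?L (v \<otimes> w)"
      by (simp add: tensor_def coordinate_in_dual w.scale_sum_right)
    finally show ?thesis by simp
  qed
  ultimately have "\<exists>L. linear_on tensor2_space tscale2 s L \<and> (\<forall>v w. L (v \<otimes> w) = b v w)"
    by blast
  from someI_ex[OF this]
  show "linear_on tensor2_space tscale2 s (tensor_lift s b)" "tensor_lift s b (v \<otimes> w) = b v w"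
    unfolding tensor_lift_def by auto
qed

lemma tensor_map_tensor:
  assumes "Vector_Spaces.linear scale scale f" "Vector_Spaces.linear scale scale g"
  shows "tensor_map f g (v \<otimes> w) = f v \<otimes> g w"
  unfolding tensor_map_def using assms
  by (subst tensor_lift)
    (auto simp: Vector_Spaces.linear_iff vector_space_tscale2 tensor_add_left tensor_add_right
      tensor_scale_left tensor_scale_right)

lemma tensor_basis_eval:
  assumes "i \<in> Basis" "j \<in> Basis"
  shows "(i \<otimes> j) (\<lambda>v. representation Basis v k) (\<lambda>v. representation Basis v l) =
    (if i = k \<and> j = l then 1 else 0)"
  using assms by (simp add: tensor_def coordinate_in_dual representation_basis independent_Basis)

lemma tensor2_Basis_eq: "tensor2_Basis = (\<lambda>(i, j). i \<otimes> j) ` (Basis \<times> Basis)"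
  unfolding tensor2_Basis_def by auto

lemma tensor_eval_sum:
  "(\<Sum>x\<in>A. tscale2 (f x) x) \<phi> \<psi> = (\<Sum>x\<in>A. f x * x \<phi> \<psi>)"
  by (induction A rule: infinite_finite_induct) (simp_all add: tscale2_def)

lemma independent_tensor2_Basis: "T2.independent tensor2_Basis"
proof -
  have fin: "finite tensor2_Basis"
    unfolding tensor2_Basis_eq using finite_Basis by blast
  have zero: "f t = 0" if 0: "(\<Sum>x\<in>tensor2_Basis. tscale2 (f x) x) = 0" and t: "t \<in> tensor2_Basis"
    for f t
  proof -
    obtain k l where kl: "k \<in> Basis" "l \<in> Basis" "t = k \<otimes> l"
      using t unfolding tensor2_Basis_def by blast
    let ?k = "\<lambda>v. representation Basis v k" and ?l = "\<lambda>v. representation Basis v l"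
    have other: "f x * x ?k ?l = 0" if "x \<in> tensor2_Basis - {t}" for x
    proof -
      obtain i j where ij: "i \<in> Basis" "j \<in> Basis" "x = i \<otimes> j"
        using \<open>x \<in> tensor2_Basis - {t}\<close> unfolding tensor2_Basis_def by blast
      have "\<not> (i = k \<and> j = l)"
        using that ij(3) kl(3) by blast
      then show ?thesis
        unfolding ij(3) tensor_basis_eval[OF ij(1,2)] by auto
    qed
    have "(\<Sum>x\<in>tensor2_Basis. f x * x ?k ?l) = f t * t ?k ?l + (\<Sum>x\<in>tensor2_Basis - {t}. f x * x ?k ?l)"
      by (rule sum.remove[OF fin t])
    moreover have "(\<Sum>x\<in>tensor2_Basis - {t}. f x * x ?k ?l) = 0"
      by (rule sum.neutral) (use other in blast)
    moreover have "(\<Sum>x\<in>tensor2_Basis. f x * x ?k ?l) = 0"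
      unfolding tensor_eval_sum[symmetric] 0 by simp
    moreover have "t ?k ?l = 1"
      unfolding kl(3) tensor_basis_eval[OF kl(1,2)] by simp
    ultimately show "f t = 0"
      by (metis add.right_neutral mult.right_neutral)
  qed
  show ?thesis
    using T2.independent_if_scalars_zero[OF fin] zero by blast
qed

lemma span_tensor2_Basis: "T2.span tensor2_Basis = tensor2_space"
proof
  show "T2.span tensor2_Basis \<subseteq> tensor2_space"
    unfolding tensor2_space_def tensor2_Basis_def by (rule T2.span_mono) auto
  have right: "i \<otimes> w \<in> T2.span tensor2_Basis" if "i \<in> Basis" for i w
  proof -
    have "w \<in> span Basis" by (simp add: span_Basis)
    then show ?thesis
    proof (induction rule: span_induct_alt)
      case base
      have "i \<otimes> 0 = 0"
        by (metis T2.scale_zero_left scale_zero_left tensor_scale_right)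
      then show ?case using T2.span_zero by metis
    next
      case (step c x y)
      have "i \<otimes> x \<in> tensor2_Basis"
        using that step.hyps unfolding tensor2_Basis_def by blast
      then have "tscale2 c (i \<otimes> x) + i \<otimes> y \<in> T2.span tensor2_Basis"
        by (intro T2.span_add T2.span_scale T2.span_base step.IH)
      then show ?case unfolding tensor_add_right tensor_scale_right .
    qed
  qed
  have "v \<otimes> w \<in> T2.span tensor2_Basis" for v w
  proof -
    have "v \<in> span Basis" by (simp add: span_Basis)
    then show ?thesis
    proof (induction rule: span_induct_alt)
      case base
      have "0 \<otimes> w = 0"
        by (metis T2.scale_zero_left scale_zero_left tensor_scale_left)
      then show ?case using T2.span_zero by metis
    next
      case (step c x y)
      have "tscale2 c (x \<otimes> w) + y \<otimes> w \<in> T2.span tensor2_Basis"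
        by (intro T2.span_add T2.span_scale right step.hyps step.IH)
      then show ?case unfolding tensor_add_left tensor_scale_left .
    qed
  qed
  then show "tensor2_space \<subseteq> T2.span tensor2_Basis"
    unfolding tensor2_space_def by (intro T2.span_minimal) (auto simp: T2.subspace_span)
qed

end

context finite_dimensional_algebra
begin

lemma DN_operator:
  shows "linear_on tensor2_space tscale2 tscale2 (DN_operator x y)"
    and "DN_operator x y (a \<otimes> b) =
      tscale2 x ((a * b) \<otimes> 1) + tscale2 y (1 \<otimes> (a * b)) - tscale2 x (a \<otimes> b)"
proof -
  let ?b = "\<lambda>a b. tscale2 x ((a * b) \<otimes> 1) + tscale2 y (1 \<otimes> (a * b)) - tscale2 x (a \<otimes> b)"
  have l: "Vector_Spaces.linear scale tscale2 (\<lambda>a. ?b a b)" for b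
    unfolding Vector_Spaces.linear_iff distrib_right scale_mult_left tensor_add_left
      tensor_add_right tensor_scale_left tensor_scale_right
    by (intro conjI allI vector_space_axioms vector_space_tscale2)
      (simp_all add: tscale2_def fun_eq_iff algebra_simps)
  have r: "Vector_Spaces.linear scale tscale2 (?b a)" for a
    unfolding Vector_Spaces.linear_iff distrib_left scale_mult_right tensor_add_left
      tensor_add_right tensor_scale_left tensor_scale_right
    by (intro conjI allI vector_space_axioms vector_space_tscale2)
      (simp_all add: tscale2_def fun_eq_iff algebra_simps)
  show "linear_on tensor2_space tscale2 tscale2 (DN_operator x y)"
    and "DN_operator x y (a \<otimes> b) = ?b a b"
    unfolding DN_operator_def using tensor_lift[OF l r] by simp_all
qed

end

end

theory Submission
  imports Defs
begin

text \<open>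
  Write \<open>T a\<close> for the trace of \<open>b \<mapsto> a * \<mu> b\<close>. The partial traces of \<open>R\<^sup>\<plusminus>\<^sup>1 (Id \<otimes> \<mu>)\<close> at \<open>a\<close> are
  combinations of \<open>a * \<mu> 1\<close>, \<open>T a *s 1\<close> and \<open>a\<close>. Requiring them to be multiples of \<open>a\<close> forces, first at
  \<open>a = 1\<close>, that \<open>\<mu> 1 = d *s 1\<close>, and then, at some \<open>a\<close> that is not a scalar, that \<open>T = 0\<close>;
  the equations for \<open>x\<close> and \<open>y\<close> with \<open>c = 1 / d\<close> remain. That \<open>R\<close> commutes with \<open>\<mu> \<otimes> \<mu>\<close> says that
  \<open>z = \<mu> a * \<mu> b - d *s \<mu> (a * b)\<close> satisfies \<open>x (z \<otimes> 1) + y (1 \<otimes> z) = 0\<close>. So \<open>z\<close> is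
  a scalar, and zero if \<open>x + y \<noteq> 0\<close>; otherwise the vanishing of \<open>T\<close> has to be used once more.
\<close>

section \<open>Linear maps on tensor powers\<close>

context tensor_powers
begin

lemma tensor2_space_closed [simp]:
  "u \<in> tensor2_space \<Longrightarrow> v \<in> tensor2_space \<Longrightarrow> u + v \<in> tensor2_space"
  "u \<in> tensor2_space \<Longrightarrow> v \<in> tensor2_space \<Longrightarrow> u - v \<in> tensor2_space"
  "u \<in> tensor2_space \<Longrightarrow> tscale2 c u \<in> tensor2_space"
  unfolding tensor2_space_def by (auto intro: T2.span_add T2.span_diff T2.span_scale)

text \<open>\<open>linear_on\<close> says nothing about the range of \<open>f\<close>. The tensors
  that \<open>f\<close> sends into the tensor power form a subspace, so pure tensors decide.\<close>

lemma linear_on_tensor2_closed: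
  assumes f: "linear_on tensor2_space tscale2 tscale2 f"
    and pure: "\<And>v w. f (v \<otimes> w) \<in> tensor2_space" and t: "t \<in> tensor2_space"
  shows "f t \<in> tensor2_space"
proof -
  have add: "f (u + v) = f u + f v" if "u \<in> tensor2_space" "v \<in> tensor2_space" for u v
    using f that unfolding linear_on_def by blast
  have scale: "f (tscale2 c u) = tscale2 c (f u)" if "u \<in> tensor2_space" for c u
    using f that unfolding linear_on_def by blast
  have zero: "0 \<in> tensor2_space"
    unfolding tensor2_space_def by (rule T2.span_zero)
  have "f 0 = 0"
    using scale[OF zero, of 0] unfolding T2.scale_zero_left .
  then have "T2.subspace {u \<in> tensor2_space. f u \<in> tensor2_space}"
    unfolding T2.subspace_def mem_Collect_eq
    using zero by (intro conjI ballI allI impI)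
      (simp_all only: add scale tensor2_space_closed mem_Collect_eq simp_thms)
  then have "T2.span {v \<otimes> w | v w. True} \<subseteq> {u \<in> tensor2_space. f u \<in> tensor2_space}"
    using pure by (intro T2.span_minimal) auto
  then show ?thesis
    using t unfolding tensor2_space_def by blast
qed

lemma linear_on_tensor2_compose:
  assumes "linear_on tensor2_space tscale2 tscale2 f"
    and "\<And>t. t \<in> tensor2_space \<Longrightarrow> f t \<in> tensor2_space"
    and "linear_on tensor2_space tscale2 tscale2 g"
  shows "linear_on tensor2_space tscale2 tscale2 (\<lambda>t. g (f t))"
  using assms unfolding linear_on_def by simp

lemma linear_on_tensor2_diff:
  assumes f: "linear_on tensor2_space tscale2 tscale2 f"
    and "u \<in> tensor2_space" "v \<in> tensor2_space"
  shows "f (u - v) = f u - f v"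
proof -
  have "u - v = u + tscale2 (- 1) v"
    by (simp add: tscale2_def fun_eq_iff)
  moreover have "tscale2 (- 1) v \<in> tensor2_space"
    using assms(3) unfolding tensor2_space_def by (rule T2.span_scale)
  moreover have "f (tscale2 (- 1) v) = tscale2 (- 1) (f v)"
    using f assms(3) unfolding linear_on_def by blast
  moreover have "f (u + tscale2 (- 1) v) = f u + f (tscale2 (- 1) v)"
    using f assms(2) calculation(2) unfolding linear_on_def by blast
  ultimately show ?thesis
    by (metis (no_types, lifting) T2.scale_minus_left T2.scale_one add_uminus_conv_diff)
qed

section \<open>The third tensor power: slices, and linearity of the legs\<close>

lemma tensor3_space_closed [simp]:
  "u \<in> tensor3_space \<Longrightarrow> v \<in> tensor3_space \<Longrightarrow> u + v \<in> tensor3_space"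
  "u \<in> tensor3_space \<Longrightarrow> v \<in> tensor3_space \<Longrightarrow> u - v \<in> tensor3_space"
  "u \<in> tensor3_space \<Longrightarrow> tscale3 c u \<in> tensor3_space"
  "tensor3 a b d \<in> tensor3_space"
  unfolding tensor3_space_def
  by (auto intro: T3.span_add T3.span_diff T3.span_scale T3.span_base)

text \<open>The legs apply \<open>R\<close> to slices of a 3-tensor, and linearity of
  \<open>R\<close> is available only on \<open>tensor2_space\<close>. Fixing one argument of a pure
  3-tensor leaves a multiple of a pure 2-tensor, so slices do lie there.\<close>

lemma tensor3_space_slices:
  assumes "t \<in> tensor3_space"
  shows "(\<lambda>\<phi> \<psi>. t \<phi> \<psi> \<chi>) \<in> tensor2_space" and "t \<chi> \<in> tensor2_space"
proof -
  have "(\<lambda>\<phi> \<psi>. t \<phi> \<psi> \<chi>) \<in> tensor2_space \<and> t \<chi> \<in> tensor2_space"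
    using assms[unfolded tensor3_space_def]
  proof (induction rule: T3.span_induct_alt)
    case base
    have "(0 :: ('a, 'b) tensor2) \<in> tensor2_space"
      unfolding tensor2_space_def by (rule T2.span_zero)
    then show ?case by (simp add: zero_fun_def)
  next
    case (step c x y)
    obtain u v w where x: "x = tensor3 u v w" using step.hyps by blast
    have "(\<lambda>\<phi> \<psi>. (tscale3 c x + y) \<phi> \<psi> \<chi>) =
        tscale2 (c * (if \<chi> \<in> dual then \<chi> w else 0)) (u \<otimes> v) + (\<lambda>\<phi> \<psi>. y \<phi> \<psi> \<chi>)"
      unfolding x by (auto simp: tensor3_def tensor_def tscale2_def tscale3_def fun_eq_iff)
    moreover have "(tscale3 c x + y) \<chi> =
        tscale2 (c * (if \<chi> \<in> dual then \<chi> u else 0)) (v \<otimes> w) + y \<chi>"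
      unfolding x by (auto simp: tensor3_def tensor_def tscale2_def tscale3_def fun_eq_iff)
    ultimately show ?case
      using step.IH tensor2_space_closed(1,3) tensor_in_space by presburger
  qed
  then show "(\<lambda>\<phi> \<psi>. t \<phi> \<psi> \<chi>) \<in> tensor2_space" "t \<chi> \<in> tensor2_space" by auto
qed

lemma leg12_linear:
  assumes R: "linear_on tensor2_space tscale2 tscale2 R"
    and s: "s \<in> tensor3_space"
  shows "t \<in> tensor3_space \<Longrightarrow> leg12 R (s + t) = leg12 R s + leg12 R t"
    and "t \<in> tensor3_space \<Longrightarrow> leg12 R (s - t) = leg12 R s - leg12 R t"
    and "leg12 R (tscale3 c s) = tscale3 c (leg12 R s)"
proof -
  note slices = tensor3_space_slices(1)[OF s] tensor3_space_slices(1)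
  have eqs: "(\<lambda>\<phi> \<psi>. (s + t) \<phi> \<psi> \<chi>) = (\<lambda>\<phi> \<psi>. s \<phi> \<psi> \<chi>) + (\<lambda>\<phi> \<psi>. t \<phi> \<psi> \<chi>)"
    "(\<lambda>\<phi> \<psi>. (s - t) \<phi> \<psi> \<chi>) = (\<lambda>\<phi> \<psi>. s \<phi> \<psi> \<chi>) - (\<lambda>\<phi> \<psi>. t \<phi> \<psi> \<chi>)"
    "(\<lambda>\<phi> \<psi>. tscale3 c s \<phi> \<psi> \<chi>) = tscale2 c (\<lambda>\<phi> \<psi>. s \<phi> \<psi> \<chi>)" for \<chi>
    by (auto simp: tscale2_def tscale3_def fun_eq_iff)
  have add: "R (u + v) = R u + R v" if "u \<in> tensor2_space" "v \<in> tensor2_space" for u v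
    using R that unfolding linear_on_def by auto
  have scale: "R (tscale2 c u) = tscale2 c (R u)" if "u \<in> tensor2_space" for u
    using R that unfolding linear_on_def by auto
  show "leg12 R (s + t) = leg12 R s + leg12 R t" if "t \<in> tensor3_space"
    unfolding leg12_def eqs add[OF slices(1) slices(2)[OF that]] by (simp add: fun_eq_iff)
  show "leg12 R (s - t) = leg12 R s - leg12 R t" if "t \<in> tensor3_space"
    unfolding leg12_def eqs linear_on_tensor2_diff[OF R slices(1) slices(2)[OF that]]
    by (simp add: fun_eq_iff)
  show "leg12 R (tscale3 c s) = tscale3 c (leg12 R s)"
    unfolding leg12_def eqs scale[OF slices(1)] by (simp add: fun_eq_iff tscale2_def tscale3_def)
qed

lemma leg23_linear:
  assumes R: "linear_on tensor2_space tscale2 tscale2 R"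
    and s: "s \<in> tensor3_space"
  shows "t \<in> tensor3_space \<Longrightarrow> leg23 R (s + t) = leg23 R s + leg23 R t"
    and "t \<in> tensor3_space \<Longrightarrow> leg23 R (s - t) = leg23 R s - leg23 R t"
    and "leg23 R (tscale3 c s) = tscale3 c (leg23 R s)"
proof -
  note slices = tensor3_space_slices(2)[OF s] tensor3_space_slices(2)
  have eqs: "(s + t) \<chi> = s \<chi> + t \<chi>" "(s - t) \<chi> = s \<chi> - t \<chi>"
    "tscale3 c s \<chi> = tscale2 c (s \<chi>)" for \<chi>
    by (auto simp: tscale2_def tscale3_def fun_eq_iff)
  have add: "R (u + v) = R u + R v" if "u \<in> tensor2_space" "v \<in> tensor2_space" for u v
    using R that unfolding linear_on_def by auto
  have scale: "R (tscale2 c u) = tscale2 c (R u)" if "u \<in> tensor2_space" for u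
    using R that unfolding linear_on_def by auto
  show "leg23 R (s + t) = leg23 R s + leg23 R t" if "t \<in> tensor3_space"
    unfolding leg23_def eqs add[OF slices(1) slices(2)[OF that]] by (simp add: fun_eq_iff)
  show "leg23 R (s - t) = leg23 R s - leg23 R t" if "t \<in> tensor3_space"
    unfolding leg23_def eqs linear_on_tensor2_diff[OF R slices(1) slices(2)[OF that]]
    by (simp add: fun_eq_iff)
  show "leg23 R (tscale3 c s) = tscale3 c (leg23 R s)"
    unfolding leg23_def eqs scale[OF slices(1)] by (simp add: fun_eq_iff tscale2_def tscale3_def)
qed

end

section \<open>Coordinates, traces and a linear equation between tensors\<close>

context finite_dimensional_tensor_powers
begin

abbreviation coord :: "'b \<Rightarrow> 'b \<Rightarrow> 'a"
  where "coord i \<equiv> \<lambda>v. representation Basis v i"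

lemma linear_sum_coord:
  assumes "Vector_Spaces.linear scale s f"
  shows "f v = (\<Sum>i\<in>Basis. s (coord i v) (f i))"
proof -
  interpret f: Vector_Spaces.linear scale s f by fact
  have "f v = f (\<Sum>i\<in>Basis. coord i v *s i)" by (simp add: basis_expansion)
  then show ?thesis by (simp add: f.sum f.scale)
qed

text \<open>Tensors are forms on the dual, and evaluation at two coordinate functionals is 1 on one
  basis tensor and 0 on the others. This makes the coefficients inside \<open>Sp2\<close>
  computable.\<close>

lemma tensor2_representation:
  assumes t: "t \<in> tensor2_space" and "j \<in> Basis" "m \<in> Basis"
  shows "T2.representation tensor2_Basis t (j \<otimes> m) = t (coord j) (coord m)"
proof -
  let ?r = "T2.representation tensor2_Basis t"
  have fin: "finite tensor2_Basis"
    unfolding tensor2_Basis_eq using finite_Basis by blast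
  have "t = (\<Sum>b\<in>tensor2_Basis. tscale2 (?r b) b)"
    using T2.sum_representation_eq[OF independent_tensor2_Basis _ fin subset_refl, of t] t
    by (simp add: span_tensor2_Basis)
  then have "t (coord j) (coord m) = (\<Sum>b\<in>tensor2_Basis. tscale2 (?r b) b) (coord j) (coord m)"
    by (rule fun_cong[OF fun_cong])
  also have "\<dots> = (\<Sum>b\<in>tensor2_Basis. ?r b * b (coord j) (coord m))"
    by (rule tensor_eval_sum)
  also have "\<dots> = (\<Sum>b\<in>tensor2_Basis. if b = j \<otimes> m then ?r b else 0)"
  proof (rule sum.cong[OF refl])
    fix b assume "b \<in> tensor2_Basis"
    then obtain i l where b: "b = i \<otimes> l" "i \<in> Basis" "l \<in> Basis"
      unfolding tensor2_Basis_def by blast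
    show "?r b * b (coord j) (coord m) = (if b = j \<otimes> m then ?r b else 0)"
    proof (cases "b = j \<otimes> m")
      case True
      then show ?thesis using tensor_basis_eval[OF assms(2,3), of j m] by simp
    next
      case False
      then have "\<not> (i = j \<and> l = m)" using b(1) by blast
      then show ?thesis
        using tensor_basis_eval[OF b(2,3), of j m] False unfolding b(1) by auto
    qed
  qed
  also have "\<dots> = ?r (j \<otimes> m)"
  proof -
    have "j \<otimes> m \<in> tensor2_Basis" using assms(2,3) unfolding tensor2_Basis_def by blast
    then show ?thesis unfolding sum.delta'[OF fin] sum.delta[OF fin] by (rule if_P)
  qed
  finally show ?thesis by (rule sym)
qed

lemma tensor_apply_dual:
  "\<phi> \<in> dual \<Longrightarrow> \<psi> \<in> dual \<Longrightarrow> (v \<otimes> w) \<phi> \<psi> = \<phi> v * \<psi> w"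
  by (simp add: tensor_def)

lemma coord_eqI:
  assumes "\<And>i. i \<in> Basis \<Longrightarrow> coord i v = coord i w"
  shows "v = w"
proof -
  have "(\<Sum>i\<in>Basis. coord i v *s i) = (\<Sum>i\<in>Basis. coord i w *s i)"
    by (rule sum.cong) (simp_all add: assms)
  then show ?thesis unfolding basis_expansion .
qed

lemma trace_add: "trace (\<lambda>v. f v + g v) = trace f + trace g"
  by (simp add: trace_def representation_add independent_Basis span_Basis sum.distrib)

lemma trace_scale: "trace (\<lambda>v. c *s f v) = c * trace f"
  by (simp add: trace_def representation_scale independent_Basis span_Basis sum_distrib_left)

text \<open>Holds for any functional, not only for coordinates in \<open>Basis\<close>; so a trace
  can be computed through another basis without proving that \<open>trace\<close> is independent of
  the basis.\<close>

lemma trace_rank_one: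
  assumes "\<phi> \<in> dual"
  shows "trace (\<lambda>v. \<phi> v *s w) = \<phi> w"
proof -
  have "\<phi> w = (\<Sum>i\<in>Basis. coord i w * \<phi> i)"
    using assms unfolding dual_def by (intro linear_sum_coord) simp
  then show ?thesis
    by (simp add: trace_def representation_scale independent_Basis span_Basis mult.commute)
qed

lemma tensor_map_linear:
  assumes "Vector_Spaces.linear scale scale f" "Vector_Spaces.linear scale scale g"
  shows "linear_on tensor2_space tscale2 tscale2 (tensor_map f g)"
  unfolding tensor_map_def using assms
  by (intro tensor_lift)
    (auto simp: Vector_Spaces.linear_iff vector_space_tscale2 tensor_add_left tensor_add_right
      tensor_scale_left tensor_scale_right)

text \<open>Contract the first leg with a coordinate that does not vanish on \<open>w\<close>, and
  solve for \<open>z\<close> in the second leg.\<close>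

lemma tensor_line:
  assumes "x \<noteq> 0" "y \<noteq> 0" "w \<noteq> 0" and eq: "tscale2 x (z \<otimes> w) + tscale2 y (w \<otimes> z) = 0"
  obtains s where "z = s *s w"
proof -
  obtain i where i: "i \<in> Basis" "coord i w \<noteq> 0"
    using coord_eqI[of w 0] \<open>w \<noteq> 0\<close> by (auto simp: representation_zero)
  let ?s = "- (x * coord i z / (y * coord i w))"
  have "coord j z = coord j (?s *s w)" for j
  proof -
    have "x * (coord i z * coord j w) + y * (coord i w * coord j z) = 0"
      using fun_cong[OF fun_cong[OF eq, of "coord i"], of "coord j"]
      by (simp add: tscale2_def tensor_apply_dual coordinate_in_dual)
    then have "y * coord i w * coord j z = - (x * coord i z * coord j w)"
      by (simp add: algebra_simps eq_neg_iff_add_eq_0)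
    then have "coord j z = ?s * coord j w"
      using i assms(2) by (simp add: field_simps)
    moreover have "coord j (?s *s w) = ?s * coord j w"
      using representation_scale[OF independent_Basis, of w ?s] span_Basis by simp
    ultimately show ?thesis by (rule HOL.trans[OF _ sym])
  qed
  then show ?thesis using coord_eqI that by blast
qed

end

context finite_dimensional_algebra
begin

section \<open>The Yang--Baxter equation\<close>

text \<open>The inverse of \<open>DN_operator x y\<close> is not of the form \<open>DN_operator x' y'\<close>, but both have this shape.\<close>

definition DN_family :: "'k \<Rightarrow> 'k \<Rightarrow> 'k \<Rightarrow> ('k, 'a) tensor2 \<Rightarrow> ('k, 'a) tensor2"
  where "DN_family p q r = tensor_lift tscale2
    (\<lambda>a b. tscale2 p ((a * b) \<otimes> 1) + tscale2 q (1 \<otimes> (a * b)) - tscale2 r (a \<otimes> b))"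

lemma DN_family:
  shows DN_family_linear: "linear_on tensor2_space tscale2 tscale2 (DN_family p q r)"
    and DN_family_tensor: "DN_family p q r (a \<otimes> b) =
      tscale2 p ((a * b) \<otimes> 1) + tscale2 q (1 \<otimes> (a * b)) - tscale2 r (a \<otimes> b)"
proof -
  let ?b = "\<lambda>a b. tscale2 p ((a * b) \<otimes> 1) + tscale2 q (1 \<otimes> (a * b)) - tscale2 r (a \<otimes> b)"
  have l: "Vector_Spaces.linear scale tscale2 (\<lambda>a. ?b a b)" for b
    unfolding Vector_Spaces.linear_iff distrib_right scale_mult_left tensor_add_left
      tensor_add_right tensor_scale_left tensor_scale_right
    by (intro conjI allI vector_space_axioms vector_space_tscale2)
      (simp_all add: tscale2_def fun_eq_iff algebra_simps)
  have r: "Vector_Spaces.linear scale tscale2 (?b a)" for a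
    unfolding Vector_Spaces.linear_iff distrib_left scale_mult_right tensor_add_left
      tensor_add_right tensor_scale_left tensor_scale_right
    by (intro conjI allI vector_space_axioms vector_space_tscale2)
      (simp_all add: tscale2_def fun_eq_iff algebra_simps)
  show "linear_on tensor2_space tscale2 tscale2 (DN_family p q r)"
    and "DN_family p q r (a \<otimes> b) = ?b a b"
    unfolding DN_family_def using tensor_lift[OF l r] by simp_all
qed

lemma DN_eq_family: "DN_operator x y = DN_family x y x"
  unfolding DN_operator_def DN_family_def ..

lemma DN_family_closed [simp]: "t \<in> tensor2_space \<Longrightarrow> DN_family p q r t \<in> tensor2_space"
  by (rule linear_on_tensor2_closed[OF DN_family_linear]) (simp_all add: DN_family_tensor)

lemma DN_family_simps:
  "u \<in> tensor2_space \<Longrightarrow> v \<in> tensor2_space \<Longrightarrow>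
    DN_family p q r (u + v) = DN_family p q r u + DN_family p q r v"
  "u \<in> tensor2_space \<Longrightarrow> v \<in> tensor2_space \<Longrightarrow>
    DN_family p q r (u - v) = DN_family p q r u - DN_family p q r v"
  "u \<in> tensor2_space \<Longrightarrow> DN_family p q r (tscale2 c u) = tscale2 c (DN_family p q r u)"
  using DN_family_linear[of p q r] linear_on_tensor2_diff[OF DN_family_linear]
  unfolding linear_on_def by auto

lemma tensor2_space_eqI:
  assumes "linear_on tensor2_space tscale2 tscale2 f" "linear_on tensor2_space tscale2 tscale2 g"
    and "\<And>a b. f (a \<otimes> b) = g (a \<otimes> b)" and "t \<in> tensor2_space"
  shows "f t = g t"
  using tensor_lift_unique[OF assms(1-3) vector_space_tscale2 assms(4)] .

lemma linear_on_tensor2_id: "linear_on tensor2_space tscale2 tscale2 (\<lambda>t. t)"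
  unfolding linear_on_def by simp

section \<open>The inverse operator and the braid relation\<close>

context
  fixes x y :: 'k
  assumes x: "x \<noteq> 0" and y: "y \<noteq> 0"
begin

abbreviation R where "R \<equiv> DN_family x y x"
abbreviation R' where "R' \<equiv> DN_family (inverse y) (inverse x) (inverse x)"

text \<open>For fixed \<open>a\<close> and \<open>b\<close>, both operators preserve the span of
  \<open>a \<otimes> b\<close>, \<open>(a * b) \<otimes> 1\<close> and
  \<open>1 \<otimes> (a * b)\<close>, so only coefficients of these three tensors have to be
  compared.\<close>

lemma DN_inverse_left: "t \<in> tensor2_space \<Longrightarrow> R' (R t) = t"
  by (rule tensor2_space_eqI[OF linear_on_tensor2_compose[OF DN_family_linear _ DN_family_linear]
        linear_on_tensor2_id])
    (use x y in \<open>simp_all add: DN_family_tensor DN_family_simps,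
      simp add: fun_eq_iff tscale2_def field_simps\<close>)

lemma DN_inverse_right: "t \<in> tensor2_space \<Longrightarrow> R (R' t) = t"
  by (rule tensor2_space_eqI[OF linear_on_tensor2_compose[OF DN_family_linear _ DN_family_linear]
        linear_on_tensor2_id])
    (use x y in \<open>simp_all add: DN_family_tensor DN_family_simps,
      simp add: fun_eq_iff tscale2_def field_simps\<close>)

lemma DN_bij_betw: "bij_betw R tensor2_space tensor2_space"
  by (rule bij_betw_byWitness[where f' = R']) (auto simp: DN_inverse_left DN_inverse_right)

text \<open>Puts the inverse in the enhancement condition into the shape \<open>DN_family\<close>,
  so that one computation of \<open>Sp2\<close> serves both signs.\<close>

lemma DN_inv_into: "t \<in> tensor2_space \<Longrightarrow> inv_into tensor2_space R t = R' t"
  using DN_bij_betw DN_inverse_right by (metis DN_family_closed bij_betw_inv_into_left)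

lemma leg12_DN: "leg12 R (tensor3 a b c) =
    tscale3 x (tensor3 (a * b) 1 c) + tscale3 y (tensor3 1 (a * b) c) - tscale3 x (tensor3 a b c)"
  unfolding leg12_tensor3[OF DN_family_linear] DN_family_tensor
  by (auto simp: fun_eq_iff tscale2_def tscale3_def tensor_def tensor3_def algebra_simps)

lemma leg23_DN: "leg23 R (tensor3 a b c) =
    tscale3 x (tensor3 a (b * c) 1) + tscale3 y (tensor3 a 1 (b * c)) - tscale3 x (tensor3 a b c)"
  unfolding leg23_tensor3[OF DN_family_linear] DN_family_tensor
  by (auto simp: fun_eq_iff tscale2_def tscale3_def tensor_def tensor3_def algebra_simps)

lemmas leg_DN_simps = leg12_DN leg23_DN
  leg12_linear[OF DN_family_linear] leg23_linear[OF DN_family_linear]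

lemma leg_DN_closed [simp]:
  assumes "t \<in> tensor3_space"
  shows "leg12 R t \<in> tensor3_space" "leg23 R t \<in> tensor3_space"
proof -
  \<comment> \<open>Zero is written as the difference of a 3-tensor with itself; any element of the
    third tensor power would serve.\<close>
  have zero: "leg12 R 0 = 0" "leg23 R 0 = 0"
    using leg12_linear(2)[OF DN_family_linear, of "tensor3 0 0 0" "tensor3 0 0 0"]
      leg23_linear(2)[OF DN_family_linear, of "tensor3 0 0 0" "tensor3 0 0 0"]
    by (simp_all only: diff_self tensor3_space_closed)
  have "t \<in> tensor3_space \<and> leg12 R t \<in> tensor3_space \<and> leg23 R t \<in> tensor3_space"
    using assms[unfolded tensor3_space_def]
  proof (induction rule: T3.span_induct_alt)
    case base
    then show ?case unfolding zero unfolding tensor3_space_def using T3.span_zero by blast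
  next
    case (step c u v)
    then obtain a b d where "u = tensor3 a b d" by blast
    then show ?case
      using step.IH by (simp only: leg_DN_simps tensor3_space_closed simp_thms)
  qed
  then show "leg12 R t \<in> tensor3_space" "leg23 R t \<in> tensor3_space" by auto
qed

text \<open>Both sides are linear, so pure tensors suffice. There, by associativity, both expand
  into pure tensors in \<open>1\<close>, \<open>a\<close>, \<open>b\<close>, \<open>c\<close> and
  products of consecutive factors, and a polynomial identity in \<open>x\<close> and
  \<open>y\<close> remains.\<close>

lemma DN_braid:
  assumes "t \<in> tensor3_space"
  shows "leg12 R (leg23 R (leg12 R t)) = leg23 R (leg12 R (leg23 R t))"
proof (rule linear_on_span_eq[where f = "\<lambda>t. leg12 R (leg23 R (leg12 R t))"
      and g = "\<lambda>t. leg23 R (leg12 R (leg23 R t))" and t = t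
      and G = "{tensor3 u v w | u v w. True}", OF T3.module_axioms])
  show "linear_on (T3.span {tensor3 u v w | u v w. True}) tscale3 tscale3
      (\<lambda>t. leg12 R (leg23 R (leg12 R t)))"
    "linear_on (T3.span {tensor3 u v w | u v w. True}) tscale3 tscale3
      (\<lambda>t. leg23 R (leg12 R (leg23 R t)))"
    unfolding tensor3_space_def[symmetric] linear_on_def
    by (intro conjI ballI allI; simp only: leg_DN_simps leg_DN_closed tensor3_space_closed)+
  show "t \<in> T3.span {tensor3 u v w | u v w. True}"
    using assms unfolding tensor3_space_def .
  fix s assume "s \<in> {tensor3 u v w | u v w. True}"
  then obtain a b c where s: "s = tensor3 a b c" by blast
  show "leg12 R (leg23 R (leg12 R s)) = leg23 R (leg12 R (leg23 R s))"
    unfolding s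
    by (simp only: leg_DN_simps tensor3_space_closed mult.assoc mult_1_left mult_1_right)
      (simp only: fun_eq_iff plus_fun_apply minus_apply tscale3_def, intro allI, algebra)
qed (rule vector_space_tscale3)

lemma DN_YB_operator: "YB_operator R"
  unfolding YB_operator_def using DN_family_linear DN_bij_betw DN_braid by blast

end

section \<open>The enhancement conditions\<close>

context
  fixes \<mu> :: "'a \<Rightarrow> 'a"
  assumes \<mu>: "Vector_Spaces.linear scale scale \<mu>"
begin

lemma linear_scale_id: "Vector_Spaces.linear scale scale id"
  using vector_space_axioms by (simp add: Vector_Spaces.linear_iff)

lemma \<mu>_simps: "\<mu> (a + b) = \<mu> a + \<mu> b" "\<mu> (c *s a) = c *s \<mu> a"
  using \<mu> unfolding Vector_Spaces.linear_iff by auto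

lemma linear_mult_\<mu>: "Vector_Spaces.linear scale scale (\<lambda>b. a * \<mu> b)"
  using vector_space_axioms
  by (simp add: Vector_Spaces.linear_iff \<mu>_simps distrib_left scale_mult_right)

lemma linear_trace_mult_\<mu>: "Vector_Spaces.linear scale (*) (\<lambda>a. trace (\<lambda>b. a * \<mu> b))"
proof -
  have "vector_space ((*) :: 'k \<Rightarrow> 'k \<Rightarrow> 'k)"
    by unfold_locales (auto simp: algebra_simps)
  then show ?thesis
    using vector_space_axioms
    by (simp add: Vector_Spaces.linear_iff distrib_right scale_mult_left trace_add trace_scale)
qed

text \<open>The three summands of \<open>DN_family\<close> contribute separately: a final factor
  \<open>1\<close> contracts \<open>\<mu> l\<close> to \<open>\<mu> 1\<close>, a final factor
  \<open>i * \<mu> l\<close> gives the trace of multiplication after \<mu>, and a final factor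
  \<open>\<mu> l\<close> gives \<open>trace \<mu>\<close>. The hypothesis concerns pure tensors
  only, which is all that \<open>Sp2\<close> sees.\<close>

lemma Sp2_DN_family:
  assumes "\<And>i l. F (i \<otimes> l) = DN_family p q r (i \<otimes> \<mu> l)"
  shows "Sp2 F v = p *s (v * \<mu> 1) + (q * trace (\<lambda>b. v * \<mu> b)) *s 1 - (r * trace \<mu>) *s v"
proof -
  define G where "G v = p *s (v * \<mu> 1) + (q * trace (\<lambda>b. v * \<mu> b)) *s 1 - (r * trace \<mu>) *s v" for v
  have coeff: "tensor_coeff F i l j l =
      p * (coord l 1 * coord j (i * \<mu> l)) + q * (coord j 1 * coord l (i * \<mu> l))
        - r * (coord j i * coord l (\<mu> l))" if "j \<in> Basis" "l \<in> Basis" for i j l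
    unfolding tensor_coeff_def assms using that
    by (simp add: tensor2_representation DN_family_tensor)
      (simp add: tscale2_def tensor_apply_dual coordinate_in_dual mult.commute)
  have coord1: "(\<Sum>l\<in>Basis. coord l 1 * coord j (i * \<mu> l)) = coord j (i * \<mu> 1)" for i j
  proof -
    have "i * \<mu> 1 = (\<Sum>l\<in>Basis. coord l 1 *s (i * \<mu> l))"
      using linear_sum_coord[OF linear_mult_\<mu>] .
    then show ?thesis
      by (simp add: representation_sum representation_scale independent_Basis span_Basis)
  qed
  have "(\<Sum>l\<in>Basis. tensor_coeff F i l j l) = coord j (G i)" if "j \<in> Basis" for i j
  proof -
    have "(\<Sum>l\<in>Basis. tensor_coeff F i l j l) =
        p * (\<Sum>l\<in>Basis. coord l 1 * coord j (i * \<mu> l)) + q * (coord j 1 * trace (\<lambda>b. i * \<mu> b))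
          - r * (coord j i * trace \<mu>)"
      using that by (simp add: coeff sum.distrib sum_subtractf sum_distrib_left trace_def)
    then show ?thesis
      unfolding coord1 G_def
      by (simp add: representation_add representation_diff representation_scale
          independent_Basis span_Basis algebra_simps)
  qed
  then have inner: "(\<Sum>j\<in>Basis. \<Sum>l\<in>Basis. tensor_coeff F i l j l *s j) = G i" for i
    by (simp add: scale_sum_left[symmetric] basis_expansion)
  \<comment> \<open>\<open>Sp2\<close> extends its values on \<open>Basis\<close> linearly, so
    linearity of \<open>G\<close> carries the formula from basis vectors to every
    \<open>v\<close>.\<close>
  have "Vector_Spaces.linear scale scale G"
    using vector_space_axioms linear_trace_mult_\<mu> unfolding Vector_Spaces.linear_iff G_def
    by (simp add: distrib_right scale_mult_left scale_right_distrib scale_right_diff_distrib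
        scale_left_distrib algebra_simps)
  then show ?thesis
    unfolding Sp2_def inner using linear_sum_coord G_def by metis
qed

text \<open>Translates the enhancement into equations in the algebra: the Yang--Baxter property
  holds anyway, commutation is tested on pure tensors, and the trace conditions are two instances of
  \<open>Sp2_DN_family\<close>.\<close>

lemma enhanced_DN_operator_iff:
  assumes "x \<noteq> 0" "y \<noteq> 0" "bij \<mu>" "\<alpha> \<noteq> 0" "\<beta> \<noteq> 0"
  shows "enhanced_YB_operator (DN_operator x y) \<mu> \<alpha> \<beta> \<longleftrightarrow>
    (\<forall>a b. tscale2 x ((\<mu> a * \<mu> b) \<otimes> 1) + tscale2 y (1 \<otimes> (\<mu> a * \<mu> b)) =
      tscale2 x (\<mu> (a * b) \<otimes> \<mu> 1) + tscale2 y (\<mu> 1 \<otimes> \<mu> (a * b))) \<and>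
    (\<forall>v. x *s (v * \<mu> 1) + (y * trace (\<lambda>b. v * \<mu> b)) *s 1 - (x * trace \<mu>) *s v = (\<alpha> * \<beta>) *s v) \<and>
    (\<forall>v. inverse y *s (v * \<mu> 1) + (inverse x * trace (\<lambda>b. v * \<mu> b)) *s 1
      - (inverse x * trace \<mu>) *s v = (inverse \<alpha> * \<beta>) *s v)"
    (is "_ \<longleftrightarrow> ?comm \<and> ?plus \<and> ?minus")
proof -
  let ?R = "DN_family x y x" and ?M = "tensor_map \<mu> \<mu>"
  have M: "linear_on tensor2_space tscale2 tscale2 ?M"
    by (rule tensor_map_linear[OF \<mu> \<mu>])
  have M_closed: "t \<in> tensor2_space \<Longrightarrow> ?M t \<in> tensor2_space" for t
    by (rule linear_on_tensor2_closed[OF M]) (simp_all add: tensor_map_tensor[OF \<mu> \<mu>])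
  have M_simps: "t \<in> tensor2_space \<Longrightarrow> ?M (s + t) = ?M s + ?M t"
    "t \<in> tensor2_space \<Longrightarrow> ?M (s - t) = ?M s - ?M t"
    "?M (tscale2 c s) = tscale2 c (?M s)"
    if "s \<in> tensor2_space" for s t c
    using M that linear_on_tensor2_diff[OF M] unfolding linear_on_def by auto
  \<comment> \<open>The term \<open>tscale2 x (\<mu> a \<otimes> \<mu> b)\<close> occurs on both
    sides and cancels.\<close>
  have pure: "?R (?M (a \<otimes> b)) = ?M (?R (a \<otimes> b)) \<longleftrightarrow>
      tscale2 x ((\<mu> a * \<mu> b) \<otimes> 1) + tscale2 y (1 \<otimes> (\<mu> a * \<mu> b)) =
      tscale2 x (\<mu> (a * b) \<otimes> \<mu> 1) + tscale2 y (\<mu> 1 \<otimes> \<mu> (a * b))" for a b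
    by (simp add: tensor_map_tensor[OF \<mu> \<mu>] DN_family_tensor M_simps)
  have comm: "(\<forall>t\<in>tensor2_space. ?R (?M t) = ?M (?R t)) \<longleftrightarrow> ?comm"
  proof
    assume "\<forall>t\<in>tensor2_space. ?R (?M t) = ?M (?R t)"
    then show ?comm using pure tensor_in_space by blast
  next
    assume ?comm
    then have "?R (?M (a \<otimes> b)) = ?M (?R (a \<otimes> b))" for a b
      using pure by blast
    then show "\<forall>t\<in>tensor2_space. ?R (?M t) = ?M (?R t)"
      using tensor2_space_eqI[OF linear_on_tensor2_compose[OF M M_closed DN_family_linear]
          linear_on_tensor2_compose[OF DN_family_linear DN_family_closed M]] by blast
  qed
  have "Sp2 (?R \<circ> tensor_map id \<mu>) v =
      x *s (v * \<mu> 1) + (y * trace (\<lambda>b. v * \<mu> b)) *s 1 - (x * trace \<mu>) *s v" for v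
    by (rule Sp2_DN_family) (simp add: tensor_map_tensor[OF linear_scale_id \<mu>])
  moreover have "Sp2 (inv_into tensor2_space ?R \<circ> tensor_map id \<mu>) v =
      inverse y *s (v * \<mu> 1) + (inverse x * trace (\<lambda>b. v * \<mu> b)) *s 1
        - (inverse x * trace \<mu>) *s v" for v
    by (rule Sp2_DN_family) (simp add: tensor_map_tensor[OF linear_scale_id \<mu>] DN_inv_into assms)
  ultimately show ?thesis
    unfolding enhanced_YB_operator_def DN_eq_family comm
    using DN_YB_operator \<mu> assms by simp
qed

end

section \<open>Multiplicativity from vanishing traces\<close>

text \<open>
  If the defect \<open>D a b = \<nu> a * \<nu> b - \<nu> (a * b)\<close> is nonzero somewhere, its cocycle identity forces
  the algebra to be spanned by \<open>1\<close> and a single element \<open>a\<close>. The vanishing traces then identify \<open>\<nu>\<close>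
  with the conjugation \<open>a \<mapsto> p - a\<close>, where \<open>a * a = p *s a + q *s 1\<close>, which is multiplicative.
\<close>

lemma multiplicative_if_traces_zero:
  assumes \<nu>: "Vector_Spaces.linear scale scale \<nu>" "inj \<nu>" "\<nu> 1 = 1"
    and traces: "\<And>d. trace (\<lambda>b. d * \<nu> b) = 0"
    and defect: "\<And>a b. \<exists>s. \<nu> a * \<nu> b - \<nu> (a * b) = s *s 1"
  shows "\<nu> (a * b) = \<nu> a * \<nu> b"
proof (rule ccontr)
  assume neq: "\<nu> (a * b) \<noteq> \<nu> a * \<nu> b"
  have \<nu>_simps: "\<nu> (u + v) = \<nu> u + \<nu> v" "\<nu> (c *s u) = c *s \<nu> u" for u v c
    using \<nu>(1) unfolding Vector_Spaces.linear_iff by auto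
  define D where "D u v = \<nu> u * \<nu> v - \<nu> (u * v)" for u v
  have D1: "D u 1 = 0" "D 1 u = 0" for u
    unfolding D_def by (simp_all add: \<nu>(3))
  have D_left: "D (k *s u) v = k *s D u v" for k u v
    unfolding D_def by (simp add: \<nu>_simps scale_mult_left scale_right_diff_distrib)
  have D_right: "D u (v + w) = D u v + D u w" "D u (k *s v) = k *s D u v" for k u v w
    unfolding D_def
    by (simp_all add: \<nu>_simps scale_mult_right scale_right_diff_distrib distrib_left algebra_simps)
  \<comment> \<open>Both sides equal
    \<open>\<nu> a * \<nu> b * \<nu> c - \<nu> (a * b * c)\<close>.\<close>
  have cocycle: "D a b * \<nu> c + D (a * b) c = D a (b * c) + \<nu> a * D b c" for c
    unfolding D_def by (simp add: algebra_simps mult.assoc)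
  have Dab: "D a b \<noteq> 0"
    using neq unfolding D_def by simp
  obtain \<sigma> where \<sigma>: "D a b = \<sigma> *s 1"
    using defect unfolding D_def by blast
  have "\<sigma> \<noteq> 0" using Dab \<sigma> by auto
  have expand: "\<exists>h g. c = h *s a + g *s 1" for c
  proof -
    obtain r s t where rst: "D (a * b) c = r *s 1" "D a (b * c) = s *s 1" "D b c = t *s 1"
      using defect unfolding D_def by metis
    \<comment> \<open>With all defects scalar, the cocycle identity can be solved for
      \<open>\<nu> c\<close> in terms of \<open>\<nu> a\<close> and \<open>1 = \<nu> 1\<close>;
      injectivity of \<nu> then carries the relation back to \<open>c\<close>.\<close>
    have "\<sigma> *s \<nu> c = t *s \<nu> a + (s - r) *s 1"
      using cocycle[of c] unfolding \<sigma> rst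
      by (simp add: scale_mult_left scale_mult_right scale_left_diff_distrib algebra_simps)
    then have "inverse \<sigma> *s (\<sigma> *s \<nu> c) = inverse \<sigma> *s (t *s \<nu> a + (s - r) *s 1)"
      by simp
    then have "\<nu> c = \<nu> ((inverse \<sigma> * t) *s a + (inverse \<sigma> * (s - r)) *s 1)"
      using \<open>\<sigma> \<noteq> 0\<close> by (simp add: \<nu>_simps \<nu>(3) scale_right_distrib)
    then show ?thesis using \<nu>(2) unfolding inj_def by blast
  qed
  have "a \<notin> span {1}"
  proof
    assume "a \<in> span {1}"
    then obtain k where "a = k *s 1" unfolding span_singleton by blast
    then have "D a b = 0" using D_left[of k 1 b] by (simp add: D1)
    then show False using Dab by simp
  qed
  then have ind: "independent {a, 1}"
    by (simp add: independent_insert dependent_single)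
  have "a \<noteq> 1"
    using \<open>a \<notin> span {1}\<close> span_base[of 1 "{1}"] by blast
  have span: "span {a, 1} = UNIV"
  proof -
    have "c \<in> span {a, 1}" for c
    proof -
      obtain h g where c: "c = h *s a + g *s 1" using expand by blast
      show ?thesis unfolding c by (intro span_add span_scale span_base) simp_all
    qed
    then show ?thesis by blast
  qed
  define l m where "l = (\<lambda>v. representation {a, 1} v 1)" and "m = (\<lambda>v. representation {a, 1} v a)"
  have lm: "l \<in> dual" "m \<in> dual"
    unfolding l_def m_def dual_def using linear_representation[OF ind span] by auto
  have lm_values: "l 1 = 1" "l a = 0" "m 1 = 0" "m a = 1"
    unfolding l_def m_def using \<open>a \<noteq> 1\<close> by (simp_all add: representation_basis[OF ind])
  have lm_simps: "l (u + v) = l u + l v" "m (u + v) = m u + m v"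
    "l (k *s u) = k * l u" "m (k *s u) = k * m u" for k u v
    using lm dual_add dual_scale by blast+
  have decompose: "v = m v *s a + l v *s 1" for v
  proof -
    obtain h g where v: "v = h *s a + g *s 1" using expand by blast
    show ?thesis
      unfolding v by (simp add: lm_simps lm_values)
  qed
  \<comment> \<open>In the basis \<open>{a, 1}\<close> the map
    \<open>v \<mapsto> d * \<nu> v\<close> is a sum of two rank-one maps, whose traces are
    \<open>l d\<close> and \<open>m (d * \<nu> a)\<close>.\<close>
  have trace_eq: "l d + m (d * \<nu> a) = 0" for d
  proof -
    have "d * \<nu> v = l v *s d + m v *s (d * \<nu> a)" for v
      by (subst decompose[of v])
        (simp add: \<nu>_simps \<nu>(3) distrib_left scale_mult_right add.commute)
    then have "trace (\<lambda>v. d * \<nu> v) = trace (\<lambda>v. l v *s d + m v *s (d * \<nu> a))"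
      by (intro arg_cong[where f = trace] ext)
    also have "\<dots> = trace (\<lambda>v. l v *s d) + trace (\<lambda>v. m v *s (d * \<nu> a))"
      by (rule trace_add)
    finally have "trace (\<lambda>v. d * \<nu> v) = \<dots>" .
    then show ?thesis
      using traces[of d] lm by (simp add: trace_rank_one)
  qed
  define p q where "p = m (a * a)" and "q = l (a * a)"
  have aa: "a * a = p *s a + q *s 1"
    unfolding p_def q_def by (rule decompose)
  have m_\<nu>a: "m (\<nu> a) = - 1"
    using trace_eq[of 1] by (simp add: lm_values eq_neg_iff_add_eq_0 add.commute)
  define u where "u = l (\<nu> a)"
  have \<nu>a: "\<nu> a = u *s 1 - a"
    using decompose[of "\<nu> a"] unfolding m_\<nu>a u_def by simp
  have "a * \<nu> a = u *s a + (- 1) *s (a * a)"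
    unfolding \<nu>a by (simp add: right_diff_distrib scale_mult_right)
  \<comment> \<open>The trace identity at \<open>d = a\<close>: here \<open>l a = 0\<close>, and the
    coefficient of \<open>a\<close> in \<open>a * \<nu> a\<close> is \<open>u - p\<close>.\<close>
  then have "u = p"
    using trace_eq[of a] by (simp add: lm_simps lm_values p_def del: scale_minus_left scale_one)
  have "D a a = (u *s 1 - a) * (u *s 1 - a) - (p *s (u *s 1 - a) + q *s 1)"
    unfolding D_def aa \<nu>_simps \<nu>(3) \<nu>a ..
  also have "\<dots> = a * a - p *s a - q *s 1"
    unfolding \<open>u = p\<close>
    by (simp add: left_diff_distrib right_diff_distrib scale_mult_left scale_mult_right
        scale_right_diff_distrib)
  also have "\<dots> = 0" unfolding aa by simp
  finally have Daa: "D a a = 0" .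
  have "D a b = 0"
    by (subst decompose[of b]) (simp add: D_right Daa D1)
  then show False using Dab by simp
qed

section \<open>Equivalence of the enhancement with a rescaled automorphism\<close>

lemma enhanced_DN_operator_iff_automorphism:
  assumes dim: "dimension \<ge> 2"
    and x: "x \<noteq> 0" and y: "y \<noteq> 0"
    and \<mu>: "Vector_Spaces.linear scale scale \<mu>" "bij \<mu>"
    and \<alpha>: "\<alpha> \<noteq> 0" and \<beta>: "\<beta> \<noteq> 0"
  shows "enhanced_YB_operator (DN_operator x y) \<mu> \<alpha> \<beta> \<longleftrightarrow>
    (\<exists>c. algebra_automorphism (\<lambda>a. c *s \<mu> a) \<and> x = c * \<alpha> * \<beta> \<and>
      inverse y = c * inverse \<alpha> * \<beta> \<and> (\<forall>a. trace (\<lambda>b. a * \<mu> b) = 0))"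
    (is "?enhanced \<longleftrightarrow> ?automorphism")
proof
  define T where "T a = trace (\<lambda>b. a * \<mu> b)" for a
  have T1: "trace \<mu> = T 1" unfolding T_def by simp
  assume ?enhanced
  then have
    comm: "tscale2 x ((\<mu> a * \<mu> b) \<otimes> 1) + tscale2 y (1 \<otimes> (\<mu> a * \<mu> b)) =
      tscale2 x (\<mu> (a * b) \<otimes> \<mu> 1) + tscale2 y (\<mu> 1 \<otimes> \<mu> (a * b))" and
    plus: "x *s (a * \<mu> 1) + (y * T a) *s 1 - (x * T 1) *s a = (\<alpha> * \<beta>) *s a" and
    minus: "inverse y *s (a * \<mu> 1) + (inverse x * T a) *s 1 - (inverse x * T 1) *s a =
      (inverse \<alpha> * \<beta>) *s a" for a b
    unfolding enhanced_DN_operator_iff[OF \<mu>(1) x y \<mu>(2) \<alpha> \<beta>] T1 T_def[symmetric] by blast+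
  \<comment> \<open>Obtained by solving \<open>plus\<close> at \<open>a = 1\<close> for
    \<open>\<mu> 1\<close>.\<close>
  define d where "d = (\<alpha> * \<beta> + x * T 1 - y * T 1) / x"
  have xd_eq: "x * d = \<alpha> * \<beta> + x * T 1 - y * T 1"
    unfolding d_def using x by simp
  have "x *s \<mu> 1 = (x * d) *s 1"
    using plus[of 1] unfolding xd_eq by (simp add: algebra_simps)
  then have "x *s \<mu> 1 = x *s (d *s 1)" by simp
  then have \<mu>1: "\<mu> 1 = d *s 1" using x by (simp only: scale_cancel_left) simp
  have "d \<noteq> 0"
  proof
    assume "d = 0"
    then have "\<mu> 1 = \<mu> 0" using \<mu>1 \<mu>_simps(2)[OF \<mu>(1), of 0 0] by simp
    then show False using bij_is_inj[OF \<mu>(2)] by (simp add: inj_eq)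
  qed
  obtain w where w: "w \<notin> span {1}"
  proof -
    have "\<not> UNIV \<subseteq> span {1}"
      using dim_le_card[of UNIV "{1}"] dim by (auto simp: dim_UNIV dimension_def)
    then show ?thesis using that by blast
  qed
  \<comment> \<open>Now that \<open>\<mu> 1\<close> is a scalar, \<open>plus\<close> makes a fixed
    multiple of every \<open>a\<close> a scalar. At \<open>w\<close> this forces the factor to
    vanish, and then \<open>T a = 0\<close> for all \<open>a\<close>.\<close>
  have plus': "(x * d - x * T 1 - \<alpha> * \<beta>) *s a = (- (y * T a)) *s 1" for a
    using plus[of a] unfolding \<mu>1
    by (simp add: scale_mult_right scale_left_diff_distrib algebra_simps)
  have coeff: "x * d - x * T 1 - \<alpha> * \<beta> = 0" (is "?k = 0")
  proof (rule ccontr)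
    assume "?k \<noteq> 0"
    then have "w = inverse ?k *s (?k *s w)" by simp
    then have "w \<in> span {1}"
      unfolding plus'[of w] by (metis span_base span_scale singletonI)
    then show False using w by blast
  qed
  have T: "T a = 0" for a
    using plus'[of a] y unfolding coeff by simp
  have xd: "x * d = \<alpha> * \<beta>" using coeff T by simp
  have yd: "inverse y * d = inverse \<alpha> * \<beta>"
    using minus[of 1] unfolding \<mu>1 T by simp
  \<comment> \<open>The normalisation that makes \<open>\<nu> 1 = 1\<close>.\<close>
  define c where "c = inverse d"
  define \<nu> where "\<nu> a = c *s \<mu> a" for a
  have c: "c \<noteq> 0" using \<open>d \<noteq> 0\<close> unfolding c_def by simp
  have \<nu>_linear: "Vector_Spaces.linear scale scale \<nu>"
    using \<mu>(1) unfolding Vector_Spaces.linear_iff \<nu>_def by (simp add: scale_right_distrib mult.commute)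
  have \<nu>_bij: "bij \<nu>"
  proof -
    have "bij (scale c)"
      by (rule o_bij[of "scale (inverse c)"]) (use c in \<open>auto simp: fun_eq_iff\<close>)
    then have "bij (scale c \<circ> \<mu>)" using \<mu>(2) by (rule bij_comp[rotated])
    moreover have "scale c \<circ> \<mu> = \<nu>" by (simp add: fun_eq_iff \<nu>_def)
    ultimately show ?thesis by simp
  qed
  have \<nu>1: "\<nu> 1 = 1" unfolding \<nu>_def \<mu>1 c_def using \<open>d \<noteq> 0\<close> by simp
  have "\<exists>s. \<nu> a * \<nu> b - \<nu> (a * b) = s *s 1" for a b
  proof -
    \<comment> \<open>\<open>z\<close> is \<open>d * d\<close> times the defect of \<nu>. After
      cancelling the terms in \<open>\<mu> (a * b)\<close>, \<open>comm\<close> becomes the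
      hypothesis of \<open>tensor_line\<close> with \<open>w = 1\<close>.\<close>
    define z where "z = \<mu> a * \<mu> b - d *s \<mu> (a * b)"
    have split: "\<mu> a * \<mu> b = z + d *s \<mu> (a * b)" unfolding z_def by simp
    have "tscale2 x (z \<otimes> 1) + tscale2 y (1 \<otimes> z) = 0"
      using comm[of a b] unfolding \<mu>1 split tensor_add_left tensor_add_right tensor_scale_left
        tensor_scale_right T2.scale_right_distrib
      by (simp add: fun_eq_iff algebra_simps)
    then obtain s where "z = s *s 1"
      using tensor_line[OF x y, of 1 z] by auto
    then have "\<nu> a * \<nu> b - \<nu> (a * b) = (c * c * s) *s 1"
      using \<open>d \<noteq> 0\<close> unfolding \<nu>_def
      by (simp add: scale_mult_left scale_mult_right split scale_right_distrib c_def)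
    then show ?thesis by blast
  qed
  moreover have "trace (\<lambda>b. a * \<nu> b) = 0" for a
    by (simp add: \<nu>_def scale_mult_right trace_scale T[unfolded T_def])
  ultimately have "\<nu> (a * b) = \<nu> a * \<nu> b" for a b
    using multiplicative_if_traces_zero[OF \<nu>_linear bij_is_inj[OF \<nu>_bij] \<nu>1] by blast
  then have "algebra_automorphism (\<lambda>a. c *s \<mu> a)"
    unfolding algebra_automorphism_def \<nu>_def[symmetric] using \<nu>_linear \<nu>_bij \<nu>1 by blast
  moreover have "x = c * \<alpha> * \<beta>" "inverse y = c * inverse \<alpha> * \<beta>"
    using xd yd \<open>d \<noteq> 0\<close> \<alpha> \<beta> y unfolding c_def by (simp_all add: field_simps)
  ultimately show ?automorphism using T unfolding T_def by blast
next
  assume ?automorphism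
  then obtain c where auto: "algebra_automorphism (\<lambda>a. c *s \<mu> a)"
    and xc: "x = c * \<alpha> * \<beta>" and yc: "inverse y = c * inverse \<alpha> * \<beta>"
    and T: "\<And>a. trace (\<lambda>b. a * \<mu> b) = 0" by blast
  have c: "c \<noteq> 0" using x xc by auto
  have "c *s \<mu> 1 = c *s (inverse c *s 1)"
    using auto c unfolding algebra_automorphism_def by simp
  then have \<mu>1: "\<mu> 1 = inverse c *s 1" using c by (simp only: scale_cancel_left) simp
  have mult: "\<mu> a * \<mu> b = inverse c *s \<mu> (a * b)" for a b
  proof -
    have "c *s \<mu> (a * b) = c *s (c *s (\<mu> a * \<mu> b))"
      using auto unfolding algebra_automorphism_def
      by (simp add: scale_mult_left scale_mult_right)
    then have "\<mu> (a * b) = c *s (\<mu> a * \<mu> b)" using c by (simp only: scale_cancel_left) simp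
    then show ?thesis using c by simp
  qed
  have T1: "trace \<mu> = 0" using T[of 1] by simp
  have scaled: "x * inverse c = \<alpha> * \<beta>" "inverse y * inverse c = inverse \<alpha> * \<beta>"
    unfolding yc using c by (simp_all add: xc)
  \<comment> \<open>With \<open>\<mu> 1\<close> and \<open>\<mu> a * \<mu> b\<close> replaced, the
    factor \<open>inverse c\<close> moves across the tensor sign and commutation becomes an
    identity; the trace conditions reduce to \<open>scaled\<close>.\<close>
  show ?enhanced
    unfolding enhanced_DN_operator_iff[OF \<mu>(1) x y \<mu>(2) \<alpha> \<beta>] T T1 mult \<mu>1
      tensor_scale_left tensor_scale_right
    by (simp add: scale_mult_right scaled)
qed

end

theorem lemma4p1:
  fixes scale :: "'k::field \<Rightarrow> 'a::ring_1 \<Rightarrow> 'a"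
    and Basis :: "'a set"
    and x y \<alpha> \<beta> :: 'k
    and \<mu> :: "'a \<Rightarrow> 'a"
  assumes "CHAR('k) \<noteq> 2"
    and "finite_dimensional_algebra scale Basis"
    and "finite_dimensional_vector_space.dimension Basis \<ge> 2"
    and "x \<noteq> 0" and "y \<noteq> 0"
    and "Vector_Spaces.linear scale scale \<mu>" and "bij \<mu>"
    and "\<alpha> \<noteq> 0" and "\<beta> \<noteq> 0"
  shows "finite_dimensional_tensor_powers.enhanced_YB_operator scale Basis
           (finite_dimensional_algebra.DN_operator scale x y) \<mu> \<alpha> \<beta> \<longleftrightarrow>
    (\<exists>c. finite_dimensional_algebra.algebra_automorphism scale (\<lambda>a. scale c (\<mu> a)) \<and>
         x = c * \<alpha> * \<beta> \<and>
         inverse y = c * inverse \<alpha> * \<beta> \<and>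
         (\<forall>a. finite_dimensional_tensor_powers.trace scale Basis (\<lambda>b. a * \<mu> b) = 0))"
proof -
  interpret finite_dimensional_algebra scale Basis by fact
  show ?thesis
    using assms(3-) by (intro enhanced_DN_operator_iff_automorphism)
qed

end
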